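(* Let $\mu,p,l$ be positive integers with $l\ne 2,6$, and let $k_1,\dots,k_l$ be non-negative integers (some of the $k_i$ may be zero). If for each $k\in\{k_1,\dots,k_l\}$ there exists a $(\mu,k,p)$ Latin trade, then there exists a $(\mu,\,k_1+\cdots+k_l,\,lp)$ Latin trade.
   Context: A partial Latin square is a square array, some of whose cells are filled with symbols from a finite set and the others empty, such that each symbol occurs at most once in each row and at most once in each column. For a positive integer $\mu$, a $\mu$-way Latin trade is a tuple $(T_1,\dots,T_\mu)$ of partial Latin squares with exactly the same set of filled cells such that: every filled cell $(i,j)$ contains pairwise different entries in $T_1,\dots,T_\mu$; for each row $i$, the set of symbols in row $i$ is the same in all of $T_1,\dots,T_\mu$; and for each column $j$, the set of symbols in column $j$ is the same in all of $T_1,\dots,T_\mu$. For $\mu\le k\le m$, a $(\mu,k,m)$ Latin trade (also called a $\mu$-way $k$-homogeneous Latin trade) is a $\mu$-way Latin trade $(T_1,\dots,T_\mu)$ consisting of $m\times m$ arrays on a set of $m$ symbols such that in each $T_r$ every row has exactly $k$ filled cells, every column has exactly $k$ filled cells, and every symbol appears exactly $k$ times. By convention, for $k=0$ a $(\mu,0,m)$ Latin trade is the tuple of $\mu$ empty $m\times m$ arrays, and it always exists. *)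

theory Defs
  imports Main
begin

text \<open>
  An \<open>n \<times> n\<close> array with possibly empty cells is a map on \<open>nat \<times> nat\<close> whose domain, the set
  of filled cells, lies in \<open>{..<n} \<times> {..<n}\<close>; rows and columns are numbered from 0.
\<close>

type_synonym 'a parray = "nat \<times> nat \<rightharpoonup> 'a"

definition partial_latin_square :: "nat \<Rightarrow> 'a set \<Rightarrow> 'a parray \<Rightarrow> bool" where
  "partial_latin_square n S L \<longleftrightarrow>
     finite S \<and> dom L \<subseteq> {..<n} \<times> {..<n} \<and> ran L \<subseteq> S \<and>
     (\<forall>i j j' s. L (i, j) = Some s \<and> L (i, j') = Some s \<longrightarrow> j = j') \<and>
     (\<forall>i i' j s. L (i, j) = Some s \<and> L (i', j) = Some s \<longrightarrow> i = i')"

definition row_symbols :: "'a parray \<Rightarrow> nat \<Rightarrow> 'a set" where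
  "row_symbols L i = {s. \<exists>j. L (i, j) = Some s}"

definition col_symbols :: "'a parray \<Rightarrow> nat \<Rightarrow> 'a set" where
  "col_symbols L j = {s. \<exists>i. L (i, j) = Some s}"

text \<open>The tuple has components \<open>T 0, \<dots>, T (\<mu> - 1)\<close>; other values of \<open>T\<close> are irrelevant.\<close>

definition latin_trade :: "nat \<Rightarrow> nat \<Rightarrow> 'a set \<Rightarrow> (nat \<Rightarrow> 'a parray) \<Rightarrow> bool" where
  "latin_trade \<mu> n S T \<longleftrightarrow>
     (\<forall>r<\<mu>. partial_latin_square n S (T r)) \<and>
     (\<forall>r<\<mu>. \<forall>q<\<mu>. dom (T r) = dom (T q)) \<and>
     (\<forall>r<\<mu>. \<forall>q<\<mu>. r \<noteq> q \<longrightarrow> (\<forall>c \<in> dom (T r). T r c \<noteq> T q c)) \<and>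
     (\<forall>r<\<mu>. \<forall>q<\<mu>. \<forall>i<n. row_symbols (T r) i = row_symbols (T q) i) \<and>
     (\<forall>r<\<mu>. \<forall>q<\<mu>. \<forall>j<n. col_symbols (T r) j = col_symbols (T q) j)"

text \<open>
  \<open>(\<mu>, k, m)\<close> Latin trade on the symbol set \<open>S\<close>. The case \<open>k = 0\<close> is exempt from
  \<open>\<mu> \<le> k\<close>; it consists of empty arrays only, see \<open>homogeneous_latin_trade_0_iff\<close> below.
\<close>

definition homogeneous_latin_trade ::
    "nat \<Rightarrow> nat \<Rightarrow> nat \<Rightarrow> 'a set \<Rightarrow> (nat \<Rightarrow> 'a parray) \<Rightarrow> bool" where
  "homogeneous_latin_trade \<mu> k m S T \<longleftrightarrow>
     (k = 0 \<or> \<mu> \<le> k \<and> k \<le> m) \<and>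
     finite S \<and> card S = m \<and> latin_trade \<mu> m S T \<and>
     (\<forall>r<\<mu>.
        (\<forall>i<m. card {j. (i, j) \<in> dom (T r)} = k) \<and>
        (\<forall>j<m. card {i. (i, j) \<in> dom (T r)} = k) \<and>
        (\<forall>s\<in>S. card {c. T r c = Some s} = k))"

lemma homogeneous_latin_trade_0_iff:
  "homogeneous_latin_trade \<mu> 0 m S T \<longleftrightarrow>
     finite S \<and> card S = m \<and> (\<forall>r<\<mu>. T r = Map.empty)"
proof
  assume h: "homogeneous_latin_trade \<mu> 0 m S T"
  have "T r = Map.empty" if r: "r < \<mu>" for r
  proof (rule ccontr)
    assume "T r \<noteq> Map.empty"
    then have "dom (T r) \<noteq> {}" by simp
    then obtain i j where ij: "(i, j) \<in> dom (T r)" by fast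
    have "partial_latin_square m S (T r)"
      using h r by (simp add: homogeneous_latin_trade_def latin_trade_def)
    then have sub: "dom (T r) \<subseteq> {..<m} \<times> {..<m}"
      by (simp add: partial_latin_square_def)
    then have "i < m" using ij by auto
    then have "card {j. (i, j) \<in> dom (T r)} = 0"
      using h r by (simp add: homogeneous_latin_trade_def)
    moreover have "finite {j. (i, j) \<in> dom (T r)}"
      by (rule finite_subset[of _ "{..<m}"]) (use sub in auto)
    ultimately show False using ij by auto
  qed
  then show "finite S \<and> card S = m \<and> (\<forall>r<\<mu>. T r = Map.empty)"
    using h by (simp add: homogeneous_latin_trade_def)
next
  assume "finite S \<and> card S = m \<and> (\<forall>r<\<mu>. T r = Map.empty)"
  then show "homogeneous_latin_trade \<mu> 0 m S T"
    unfolding homogeneous_latin_trade_def latin_trade_def partial_latin_square_def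
      row_symbols_def col_symbols_def by simp
qed

end

theory Submission imports Defs "HOL-Combinatorics.Transposition" begin

text \<open>
  Two orthogonal Latin squares of order \<open>l\<close> reduce the theorem to a substitution. Divide the
  \<open>lp \<times> lp\<close> array into \<open>l \<times> l\<close> blocks of side \<open>p\<close> and the symbols into \<open>l\<close> sets of size \<open>p\<close>. If
  the two squares have the entries \<open>s\<close> and \<open>q\<close> in cell \<open>(i, j)\<close>, place in block \<open>(i, j)\<close> a copy of
  the trade of degree \<open>k\<^sub>q\<close>, written in the symbols of the \<open>s\<close>-th set. A row meets
  every \<open>q\<close> once, because the second square is Latin, so it has \<open>k\<^sub>1 + \<dots> + k\<^sub>l\<close> filled cells; columns
  likewise. A symbol of the \<open>s\<close>-th set meets every \<open>q\<close> once because the squares are orthogonal.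
  All other requirements on a trade hold block by block, since the first square is Latin
  (\<open>homogeneous_latin_trade_blow_up\<close>).

  The roles of row, column, symbol and degree become symmetric when a pair of orthogonal squares is
  written as a set of quadruples in which any two coordinates determine the other two, that is, as a
  transversal design with four groups. The main work is the theorem of Bose, Shrikhande and Parker:
  such a design exists for every positive order except 2 and 6 (\<open>td_order_4_all\<close>). For odd orders the
  quadruples \<open>(x, x + y, x + 2y, y)\<close> modulo the order suffice (\<open>td_order_affine\<close>). For an even order
  \<open>n\<close>, Wilson's construction (\<open>td_order_wilson\<close>) produces a design of order \<open>n = 3t + u\<close> from one
  with five groups of order \<open>t\<close> and ones with four groups of orders 3, 4 and \<open>u \<le> t\<close>. If \<open>t\<close> is
  coprime to 6, then the design with five groups is affine and \<open>u = n - 3t\<close> is odd, so besides the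
  order 4 the construction needs nothing but a \<open>t\<close> coprime to 6 with \<open>n/4 \<le> t \<le> n/3\<close>. There is no such
  \<open>t\<close> for the even orders 8, 10, 12, 14, 30 and 32. Of these, 12, 30 and 32 are products, while
  8, 10, 14, and also 4, are developed from a few base blocks modulo 7, 7, 11 and 3, with 1, 3, 3 and 1
  fixed points (\<open>td_order_quasi_difference_family\<close>).
\<close>

section \<open>Transversal designs\<close>

text \<open>
  All groups carry the same point set \<open>X\<close>, so a block is a function from the group numbers to \<open>X\<close>
  whose values beyond \<open>k\<close> are arbitrary. Agreement is therefore required only below \<open>k\<close>, and
  distinct functions may represent the same block.
\<close>
definition transversal_design :: "nat \<Rightarrow> 'a set \<Rightarrow> (nat \<Rightarrow> 'a) set \<Rightarrow> bool" where
  "transversal_design k X B \<longleftrightarrow>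
     (\<forall>b\<in>B. \<forall>c<k. b c \<in> X) \<and>
     (\<forall>c<k. \<forall>d<k. c \<noteq> d \<longrightarrow> (\<forall>x\<in>X. \<forall>y\<in>X. \<exists>b\<in>B. b c = x \<and> b d = y)) \<and>
     (\<forall>b\<in>B. \<forall>b'\<in>B. \<forall>c<k. \<forall>d<k. c \<noteq> d \<and> b c = b' c \<and> b d = b' d \<longrightarrow> (\<forall>e<k. b e = b' e))"

lemma transversal_designI:
  assumes "\<And>b c. b \<in> B \<Longrightarrow> c < k \<Longrightarrow> b c \<in> X"
    and "\<And>c d x y. c < k \<Longrightarrow> d < k \<Longrightarrow> c \<noteq> d \<Longrightarrow> x \<in> X \<Longrightarrow> y \<in> X \<Longrightarrow> \<exists>b\<in>B. b c = x \<and> b d = y"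
    and "\<And>b b' c d e. b \<in> B \<Longrightarrow> b' \<in> B \<Longrightarrow> c < k \<Longrightarrow> d < k \<Longrightarrow> c \<noteq> d \<Longrightarrow> b c = b' c \<Longrightarrow> b d = b' d
           \<Longrightarrow> e < k \<Longrightarrow> b e = b' e"
  shows "transversal_design k X B"
  unfolding transversal_design_def
proof (intro conjI ballI allI impI, goal_cases)
  case (3 b b' c d e)
  then show ?case using assms(3)[of b b' c d e] by simp
qed (simp_all add: assms(1,2))

lemma transversal_design_point:
  "transversal_design k X B \<Longrightarrow> b \<in> B \<Longrightarrow> c < k \<Longrightarrow> b c \<in> X"
  unfolding transversal_design_def by (elim conjE) simp

lemma transversal_design_joining_block:
  assumes "transversal_design k X B" "c < k" "d < k" "c \<noteq> d" "x \<in> X" "y \<in> X"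
  shows "\<exists>b\<in>B. b c = x \<and> b d = y"
  using assms unfolding transversal_design_def by (elim conjE) simp

lemma transversal_design_unique:
  assumes "transversal_design k X B" "b \<in> B" "b' \<in> B" "c < k" "d < k" "c \<noteq> d"
    "b c = b' c" "b d = b' d" "e < k"
  shows "b e = b' e"
proof -
  have *: "\<forall>b\<in>B. \<forall>b'\<in>B. \<forall>c<k. \<forall>d<k.
          c \<noteq> d \<and> b c = b' c \<and> b d = b' d \<longrightarrow> (\<forall>e<k. b e = b' e)"
    using assms(1) unfolding transversal_design_def by (elim conjE)
  show ?thesis
    using assms(6-8) by (intro *[rule_format, OF assms(2-5) _ assms(9)]) simp
qed

text \<open>
  Each group may be renamed independently, since no condition compares points of different groups.
\<close>
lemma transversal_design_relabel:
  assumes td: "transversal_design k X B" and bij: "\<And>c. c < k \<Longrightarrow> bij_betw (\<phi> c) X Y"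
  shows "transversal_design k Y ((\<lambda>b c. \<phi> c (b c)) ` B)"
proof (rule transversal_designI)
  fix b c assume "b \<in> (\<lambda>b c. \<phi> c (b c)) ` B" "c < k"
  then obtain a where "a \<in> B" "b c = \<phi> c (a c)" by blast
  then show "b c \<in> Y"
    using transversal_design_point[OF td, of a c] bij_betwE[OF bij[OF \<open>c < k\<close>]] \<open>c < k\<close> by simp
next
  fix c d x y assume cd: "c < k" "d < k" "c \<noteq> d" and "x \<in> Y" "y \<in> Y"
  then have "x \<in> \<phi> c ` X" "y \<in> \<phi> d ` X"
    using bij by (simp_all add: bij_betw_def)
  then obtain x' y' where xy: "x' \<in> X" "x = \<phi> c x'" "y' \<in> X" "y = \<phi> d y'"
    by blast
  obtain a where "a \<in> B" "a c = x'" "a d = y'"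
    using transversal_design_joining_block[OF td cd xy(1,3)] by blast
  then show "\<exists>b\<in>(\<lambda>b c. \<phi> c (b c)) ` B. b c = x \<and> b d = y"
    using xy by (intro bexI[of _ "\<lambda>c. \<phi> c (a c)"]) auto
next
  fix b b' c d e
  assume "b \<in> (\<lambda>b c. \<phi> c (b c)) ` B" "b' \<in> (\<lambda>b c. \<phi> c (b c)) ` B"
    and cd: "c < k" "d < k" "c \<noteq> d" and eq: "b c = b' c" "b d = b' d" and e: "e < k"
  then obtain a a' where a: "a \<in> B" "a' \<in> B" and b: "b = (\<lambda>c. \<phi> c (a c))" "b' = (\<lambda>c. \<phi> c (a' c))"
    by blast
  have cancel: "a c = a' c" if "c < k" "\<phi> c (a c) = \<phi> c (a' c)" for c
    using bij_betw_imp_inj_on[OF bij[OF that(1)]] that(2)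
      transversal_design_point[OF td a(1) that(1)] transversal_design_point[OF td a(2) that(1)]
    by (rule inj_onD)
  have "a c = a' c" "a d = a' d"
    using eq cd b by (auto intro!: cancel)
  then show "b e = b' e"
    using transversal_design_unique[OF td a cd _ _ e] b by simp
qed

definition td_order :: "nat \<Rightarrow> nat \<Rightarrow> bool" where
  "td_order k n \<longleftrightarrow> (\<exists>B. transversal_design k {..<n} B)"

lemma transversal_design_transfer:
  assumes "transversal_design k X B" "finite X" "finite Y" "card X = card Y"
  obtains B' where "transversal_design k Y B'"
proof -
  obtain h where "bij_betw h X Y"
    using finite_same_card_bij[OF assms(2-4)] by blast
  then show ?thesis
    using that transversal_design_relabel[OF assms(1), of "\<lambda>_. h"] by blast
qed

lemma td_orderI:
  "transversal_design k X B \<Longrightarrow> finite X \<Longrightarrow> card X = n \<Longrightarrow> td_order k n"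
  unfolding td_order_def using transversal_design_transfer[of k X B "{..<n}"] by auto

lemma td_orderE:
  assumes "td_order k n" "finite X" "card X = n"
  obtains B where "transversal_design k X B"
  using assms transversal_design_transfer[of k "{..<n}" _ X] unfolding td_order_def by auto

text \<open>
  Wilson's construction removes one block from a design and identifies all its points with a point
  at infinity; exchanging two names within each group makes a block constant.
\<close>
lemma transversal_design_constant_block:
  assumes td: "transversal_design k X B" and k: "2 \<le> k" and z: "z \<in> X"
  obtains B' where "transversal_design k X B'" "(\<lambda>_. z) \<in> B'"
proof -
  obtain b where b: "b \<in> B"
    using transversal_design_joining_block[OF td, of 0 1 z z] k z by auto
  define \<phi> where "\<phi> c = (if c < k then transpose (b c) z else (\<lambda>_. z))" for c
  have "bij_betw (\<phi> c) X X" if "c < k" for c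
    using transversal_design_point[OF td b that] z that
    by (auto simp: \<phi>_def intro!: bij_betw_byWitness[of _ "transpose (b c) z"] simp: transpose_def)
  then have "transversal_design k X ((\<lambda>b c. \<phi> c (b c)) ` B)"
    by (rule transversal_design_relabel[OF td])
  moreover have "(\<lambda>c. \<phi> c (b c)) = (\<lambda>_. z)"
    by (auto simp: \<phi>_def)
  ultimately show ?thesis
    using that b by (metis (no_types, lifting) image_eqI)
qed

section \<open>Products and lines modulo an integer\<close>

lemma td_order_mult:
  assumes "td_order k m" "td_order k n"
  shows "td_order k (m * n)"
proof -
  obtain A B where A: "transversal_design k {..<m} A" and B: "transversal_design k {..<n} B"
    using assms unfolding td_order_def by blast
  have "transversal_design k ({..<m} \<times> {..<n}) ((\<lambda>(a, b) c. (a c, b c)) ` (A \<times> B))"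
  proof (rule transversal_designI)
    fix f c assume "f \<in> (\<lambda>(a, b) c. (a c, b c)) ` (A \<times> B)" "c < k"
    then show "f c \<in> {..<m} \<times> {..<n}"
      using transversal_design_point[OF A] transversal_design_point[OF B] by auto
  next
    fix c d x y
    assume cd: "c < k" "d < k" "c \<noteq> d" and xy: "x \<in> {..<m} \<times> {..<n}" "y \<in> {..<m} \<times> {..<n}"
    obtain a where a: "a \<in> A" "a c = fst x" "a d = fst y"
      using transversal_design_joining_block[OF A cd, of "fst x" "fst y"] xy by auto
    obtain b where b: "b \<in> B" "b c = snd x" "b d = snd y"
      using transversal_design_joining_block[OF B cd, of "snd x" "snd y"] xy by auto
    show "\<exists>f\<in>(\<lambda>(a, b) c. (a c, b c)) ` (A \<times> B). f c = x \<and> f d = y"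
      using a b by (intro bexI[of _ "\<lambda>c. (a c, b c)"]) auto
  next
    fix f f' c d e
    assume "f \<in> (\<lambda>(a, b) c. (a c, b c)) ` (A \<times> B)" "f' \<in> (\<lambda>(a, b) c. (a c, b c)) ` (A \<times> B)"
      and cd: "c < k" "d < k" "c \<noteq> d" and eq: "f c = f' c" "f d = f' d" and e: "e < k"
    then show "f e = f' e"
      using transversal_design_unique[OF A _ _ cd _ _ e] transversal_design_unique[OF B _ _ cd _ _ e]
      by auto
  qed
  then show ?thesis
    by (rule td_orderI) auto
qed

text \<open>
  If \<open>|X|\<^sup>2\<close> blocks never share two points, then each of the \<open>|X|\<^sup>2\<close> pairs of points in two groups
  is joined, by the pigeonhole principle.
\<close>
lemma transversal_design_by_counting:
  assumes fin: "finite X" and card: "card P = (card X)\<^sup>2" "finite P"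
    and pt: "\<And>p c. p \<in> P \<Longrightarrow> c < k \<Longrightarrow> f p c \<in> X"
    and inj: "\<And>p p' c d. p \<in> P \<Longrightarrow> p' \<in> P \<Longrightarrow> c < k \<Longrightarrow> d < k \<Longrightarrow> c \<noteq> d \<Longrightarrow>
                f p c = f p' c \<Longrightarrow> f p d = f p' d \<Longrightarrow> p = p'"
  shows "transversal_design k X (f ` P)"
proof (rule transversal_designI)
  fix c d x y assume cd: "c < k" "d < k" "c \<noteq> d" and xy: "x \<in> X" "y \<in> X"
  let ?g = "\<lambda>p. (f p c, f p d)"
  have "inj_on ?g P"
    using inj[OF _ _ cd] by (auto intro!: inj_onI)
  then have "card (?g ` P) = card (X \<times> X)"
    using card by (simp add: card_image card_cartesian_product power2_eq_square)
  moreover have "?g ` P \<subseteq> X \<times> X"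
    using pt cd by auto
  ultimately have "?g ` P = X \<times> X"
    using fin by (metis card_subset_eq finite_cartesian_product)
  then have "(x, y) \<in> ?g ` P"
    using xy by blast
  then show "\<exists>b\<in>f ` P. b c = x \<and> b d = y"
    by auto
qed (use pt inj in blast)+

lemma int_range_dvd_diff_eq:
  assumes "x < t" "x' < (t::nat)" "int t dvd int x - int x'"
  shows "x = x'"
  using assms by (metis mod_eq_dvd_iff mod_less of_nat_eq_iff of_nat_mod)

text \<open>
  A block is a line of height \<open>x\<close> at 0 and of slope \<open>y\<close> modulo \<open>t\<close>, recorded by its heights
  \<open>x, x + y, \<dots>, x + (k - 1)y\<close> at \<open>0, \<dots>, k - 1\<close> and its slope. Two heights determine the line because the
  difference of their places lies between 1 and \<open>k - 1\<close>, hence is a unit. Recording the slope, which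
  determines the line together with any height, instead of the height at \<open>k\<close> saves the
  condition that \<open>k\<close> be a unit.
\<close>
lemma td_order_affine:
  assumes t: "t > 0" and cop: "\<And>d. 0 < d \<Longrightarrow> d < k \<Longrightarrow> coprime d t"
  shows "td_order (k + 1) t"
proof -
  define f where "f = (\<lambda>(x, y) c. if c = k then y else (x + c * y) mod t)"
  have f_last: "f (x, y) k = y" for x y
    by (simp add: f_def)
  have dvd: "int t dvd (int x - int x') + int c * (int y - int y')"
    if "c < k" "f (x, y) c = f (x', y') c" for x y x' y' c
  proof -
    have "int ((x + c * y) mod t) = int ((x' + c * y') mod t)"
      using that by (simp add: f_def)
    then have "int t dvd int (x + c * y) - int (x' + c * y')"
      by (simp add: mod_eq_dvd_iff zmod_int)
    also have "int (x + c * y) - int (x' + c * y') = (int x - int x') + int c * (int y - int y')"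
      by (simp add: algebra_simps)
    finally show ?thesis .
  qed
  have eqI: "x = x' \<and> y = y'"
    if xy: "x < t" "x' < t" "y < t" "y' < t" and cd: "c < d" "d < k + 1"
      and eq: "f (x, y) c = f (x', y') c" "f (x, y) d = f (x', y') d" for x y x' y' c d
  proof -
    have c: "c < k" using cd by simp
    have y: "y = y'"
    proof (cases "d = k")
      case True
      then show ?thesis using eq(2) f_last by simp
    next
      case False
      then have "d < k" using cd by simp
      have "int t dvd ((int x - int x') + int d * (int y - int y'))
              - ((int x - int x') + int c * (int y - int y'))"
        using dvd[OF c eq(1)] dvd[OF \<open>d < k\<close> eq(2)] by (rule dvd_diff[rotated])
      also have "\<dots> = int (d - c) * (int y - int y')"
        using cd by (simp add: of_nat_diff algebra_simps)
      finally have *: "int t dvd int (d - c) * (int y - int y')" .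
      have "coprime (d - c) t"
        using cop[of "d - c"] cd \<open>d < k\<close> by simp
      then have "coprime (int t) (int (d - c))"
        by (simp add: coprime_commute)
      then have "int t dvd int y - int y'"
        using * by (simp add: coprime_dvd_mult_right_iff)
      then show ?thesis
        using int_range_dvd_diff_eq xy by blast
    qed
    have "int t dvd int x - int x'"
      using dvd[OF c eq(1)] y by simp
    then show ?thesis
      using int_range_dvd_diff_eq xy y by blast
  qed
  have "transversal_design (k + 1) {..<t} (f ` ({..<t} \<times> {..<t}))"
  proof (rule transversal_design_by_counting)
    show "card ({..<t} \<times> {..<t}) = (card {..<t})\<^sup>2"
      by (simp add: power2_eq_square)
    show "f p c \<in> {..<t}" if "p \<in> {..<t} \<times> {..<t}" "c < k + 1" for p c
      using that t by (auto simp: f_def)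
    fix p p' c d
    assume p: "p \<in> {..<t} \<times> {..<t}" "p' \<in> {..<t} \<times> {..<t}"
      and cd: "c < k + 1" "d < k + 1" "c \<noteq> d" and eq: "f p c = f p' c" "f p d = f p' d"
    obtain x y x' y' where xy: "p = (x, y)" "p' = (x', y')" by (metis surj_pair)
    show "p = p'"
    proof (cases "c < d")
      case True
      show ?thesis using eqI[OF _ _ _ _ True cd(2), of x x' y y'] p eq xy by auto
    next
      case False
      then have "d < c" using cd by simp
      show ?thesis using eqI[OF _ _ _ _ \<open>d < c\<close> cd(1), of x x' y y'] p eq xy by auto
    qed
  qed auto
  then show ?thesis
    by (rule td_orderI) auto
qed

lemma td_order_odd: "odd n \<Longrightarrow> td_order 4 n"
proof -
  assume n: "odd n"
  have "td_order (3 + 1) n"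
  proof (rule td_order_affine)
    fix d :: nat assume "0 < d" "d < 3"
    then have "d = 1 \<or> d = 2" by auto
    then show "coprime d n" using n by auto
  qed (use n in presburger)
  then show ?thesis by simp
qed

lemma td_order_5_coprime_6: "coprime n 6 \<Longrightarrow> td_order 5 n"
proof -
  assume n: "coprime n 6"
  have 23: "coprime 2 n" "coprime 3 n"
    using n coprime_mult_right_iff[of n 2 3] by (simp_all add: coprime_commute)
  have "td_order (4 + 1) n"
  proof (rule td_order_affine)
    fix d :: nat assume "0 < d" "d < 4"
    then have "d = 1 \<or> d = 2 \<or> d = 3" by auto
    then show "coprime d n" using 23 by auto
  next
    show "n > 0" using n by (cases n) auto
  qed
  then show ?thesis by simp
qed

section \<open>Wilson's construction\<close>

text \<open>
  Truncate the last group of a design \<open>E\<close> of order \<open>t\<close> to \<open>u\<close> points and call these the points at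
  infinity. Every point of the first \<open>k\<close> groups is replaced by \<open>m\<close> copies, and the points at infinity
  are added to each group. A block of \<open>E\<close> whose last point was deleted is filled
  with a design of order \<open>m\<close>. If its last point \<open>z\<close> survives, it is filled with a design of order
  \<open>m + 1\<close> whose extra point is \<open>z\<close> in every group, and the block through all copies of \<open>z\<close>
  is removed, because it would occur once for each block of \<open>E\<close> through \<open>z\<close>. Two copies of points, or a copy
  of a point and a point at infinity, belong to a unique block of \<open>E\<close> and are joined once in its
  filling; two points at infinity are joined by a separate design of order \<open>u\<close>.
\<close>
lemma td_order_wilson:
  assumes k: "2 \<le> k" and u: "u \<le> t"
    and "td_order (k + 1) t" "td_order k m" "td_order k (m + 1)" "td_order k u"
  shows "td_order k (t * m + u)"
proof -
  obtain E where E: "transversal_design (k + 1) {..<t} E"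
    using assms(3) unfolding td_order_def by blast
  obtain A where A: "transversal_design k {..<m} A"
    using assms(4) unfolding td_order_def by blast
  obtain W where W: "transversal_design k {..<u} W"
    using assms(6) unfolding td_order_def by blast
  obtain A' where A': "transversal_design k {..m} A'" and const: "(\<lambda>_. m) \<in> A'"
  proof -
    obtain A0 where "transversal_design k {..m} A0"
      using td_orderE[OF assms(5), of "{..m}"] by auto
    then show ?thesis
      using transversal_design_constant_block[of k "{..m}" A0 m] k that by auto
  qed
  \<comment> \<open>The filling depends on the last point of the block alone; the point \<open>m\<close> of \<open>A'\<close>
      stands for infinity.\<close>
  define fill where "fill z = (if z < u then {a \<in> A'. \<exists>c<k. a c \<noteq> m} else A)" for z
  have fill_le: "a c \<le> m \<and> (a c = m \<longrightarrow> z < u)" if "a \<in> fill z" "c < k" for a z c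
    using that transversal_design_point[OF A] transversal_design_point[OF A']
    by (fastforce simp: fill_def split: if_splits)
  have fill_unique: "a e = a' e"
    if "a \<in> fill z" "a' \<in> fill z" "c < k" "d < k" "c \<noteq> d"
      "a c = a' c" "a d = a' d" "e < k" for a a' z c d e
  proof (cases "z < u")
    case True
    then have "a \<in> A'" "a' \<in> A'"
      using that(1,2) by (auto simp: fill_def)
    then show ?thesis by (rule transversal_design_unique[OF A']) (fact that)+
  next
    case False
    then have "a \<in> A" "a' \<in> A"
      using that(1,2) by (auto simp: fill_def)
    then show ?thesis by (rule transversal_design_unique[OF A]) (fact that)+
  qed
  have fill_inf: "a c \<noteq> m \<or> a d \<noteq> m" if "a \<in> fill z" "c < k" "d < k" "c \<noteq> d" for a z c d
  proof (rule ccontr)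
    assume "\<not> ?thesis"
    then have eq: "a c = m" "a d = m" by auto
    then have "z < u"
      using fill_le[of a z c] that by auto
    then have "a \<in> A'" and "\<exists>e<k. a e \<noteq> m"
      using that by (auto simp: fill_def)
    then show False
      using transversal_design_unique[OF A' _ const that(2-4) eq] by blast
  qed
  have fill_ex: "\<exists>a\<in>fill z. a c = i \<and> a d = j"
    if cd: "c < k" "d < k" "c \<noteq> d" and ij: "i \<le> m" "j \<le> m" "i < m \<or> j < m"
      and inf: "i = m \<or> j = m \<Longrightarrow> z < u" for z c d i j
  proof (cases "z < u")
    case True
    obtain a where "a \<in> A'" "a c = i" "a d = j"
      using transversal_design_joining_block[OF A' cd, of i j] ij by auto
    then show ?thesis
      using True ij cd by (auto simp: fill_def)
  next
    case False
    then have "i < m" "j < m"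
      using ij(1,2) inf by (fastforce simp: le_less)+
    then obtain a where "a \<in> A" "a c = i" "a d = j"
      using transversal_design_joining_block[OF A cd, of i j] by auto
    then show ?thesis
      using False by (auto simp: fill_def)
  qed
  define inflate :: "(nat \<Rightarrow> nat) \<times> (nat \<Rightarrow> nat) \<Rightarrow> nat \<Rightarrow> nat \<times> nat + nat"
    where "inflate = (\<lambda>(b, a) c. if a c < m then Inl (b c, a c) else Inr (b k))"
  let ?X = "Inl ` ({..<t} \<times> {..<m}) \<union> Inr ` {..<u} :: (nat \<times> nat + nat) set"
  let ?J = "inflate ` (SIGMA b:E. fill (b k))" and ?I = "(\<lambda>w c. Inr (w c)) ` W"
  have "transversal_design k ?X (?J \<union> ?I)"
  proof (rule transversal_designI)
    fix f c
    assume f: "f \<in> ?J \<union> ?I" and c: "c < k"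
    show "f c \<in> ?X"
    proof (cases "f \<in> ?J")
      case True
      then obtain b a where ba: "b \<in> E" "a \<in> fill (b k)" "f = inflate (b, a)" by blast
      then show ?thesis
        using fill_le[OF ba(2) c] transversal_design_point[OF E ba(1), of c] c by (auto simp: inflate_def)
    next
      case False
      then show ?thesis
        using f c transversal_design_point[OF W] by auto
    qed
  next
    fix c d x y
    assume cd: "c < k" "d < k" "c \<noteq> d" and xy: "x \<in> ?X" "y \<in> ?X"
    have cd1: "c < k + 1" "d < k + 1" "k < k + 1" "c \<noteq> k" "d \<noteq> k"
      using cd by auto
    consider (fin) x1 x2 y1 y2
        where "x = Inl (x1, x2)" "y = Inl (y1, y2)" "x1 < t" "y1 < t" "x2 < m" "y2 < m"
      | (left) x1 x2 y0 where "x = Inl (x1, x2)" "y = Inr y0" "x1 < t" "x2 < m" "y0 < u"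
      | (right) x0 y1 y2 where "x = Inr x0" "y = Inl (y1, y2)" "x0 < u" "y1 < t" "y2 < m"
      | (inf) x0 y0 where "x = Inr x0" "y = Inr y0" "x0 < u" "y0 < u"
      using xy by auto
    then show "\<exists>f\<in>?J \<union> ?I. f c = x \<and> f d = y"
    proof cases
      case fin
      obtain b where b: "b \<in> E" "b c = x1" "b d = y1"
        using transversal_design_joining_block[OF E cd1(1,2) cd(3), of x1 y1] fin by auto
      obtain a where a: "a \<in> fill (b k)" "a c = x2" "a d = y2"
        using fill_ex[OF cd, of x2 y2 "b k"] fin by auto
      have "inflate (b, a) \<in> ?J"
        using a b by auto
      moreover have "inflate (b, a) c = x" "inflate (b, a) d = y"
        using a b fin by (auto simp: inflate_def)
      ultimately show ?thesis by blast
    next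
      case left
      obtain b where b: "b \<in> E" "b c = x1" "b k = y0"
        using transversal_design_joining_block[OF E cd1(1,3,4), of x1 y0] left u by auto
      obtain a where a: "a \<in> fill (b k)" "a c = x2" "a d = m"
        using fill_ex[OF cd, of x2 m "b k"] left b by auto
      have "inflate (b, a) \<in> ?J"
        using a b by auto
      moreover have "inflate (b, a) c = x" "inflate (b, a) d = y"
        using a b left by (auto simp: inflate_def)
      ultimately show ?thesis by blast
    next
      case right
      obtain b where b: "b \<in> E" "b d = y1" "b k = x0"
        using transversal_design_joining_block[OF E cd1(2,3,5), of y1 x0] right u by auto
      obtain a where a: "a \<in> fill (b k)" "a c = m" "a d = y2"
        using fill_ex[OF cd, of m y2 "b k"] right b by auto
      have "inflate (b, a) \<in> ?J"
        using a b by auto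
      moreover have "inflate (b, a) c = x" "inflate (b, a) d = y"
        using a b right by (auto simp: inflate_def)
      ultimately show ?thesis by blast
    next
      case inf
      obtain w where "w \<in> W" "w c = x0" "w d = y0"
        using transversal_design_joining_block[OF W cd, of x0 y0] inf by auto
      then show ?thesis
        using inf by auto
    qed
  next
    fix f f' c d e
    assume f: "f \<in> ?J \<union> ?I" "f' \<in> ?J \<union> ?I" and cd: "c < k" "d < k" "c \<noteq> d"
        and eq: "f c = f' c" "f d = f' d" and e: "e < k"
    have cd1: "c < k + 1" "d < k + 1" "k < k + 1" "c \<noteq> k" "d \<noteq> k"
      using cd by auto
    \<comment> \<open>Blocks inside infinity share at most one point with the others, so the two kinds cannot
        collide.\<close>
    have J_finite: "\<exists>x. g c = Inl x \<or> g d = Inl x" if g: "g \<in> ?J" for g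
    proof -
      obtain b a where ba: "b \<in> E" "a \<in> fill (b k)" "g = inflate (b, a)"
        using g by blast
      then show ?thesis
        using fill_inf[OF ba(2) cd] fill_le[OF ba(2) cd(1)] fill_le[OF ba(2) cd(2)]
        by (auto simp: inflate_def)
    qed
    consider (J) "f \<in> ?J" "f' \<in> ?J" | (I) "f \<in> ?I" "f' \<in> ?I"
      using f eq J_finite[of f] J_finite[of f'] by auto
    then show "f e = f' e"
    proof cases
      case J
      then obtain b a b' a' where ba: "b \<in> E" "a \<in> fill (b k)" "f = inflate (b, a)"
          and ba': "b' \<in> E" "a' \<in> fill (b' k)" "f' = inflate (b', a')"
        by blast
      have ac: "a c = a' c" and ad: "a d = a' d"
        using eq ba ba' fill_le[OF ba(2) cd(1)] fill_le[OF ba(2) cd(2)] fill_le[OF ba'(2) cd(1)]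
            fill_le[OF ba'(2) cd(2)]
        by (auto simp: inflate_def split: if_splits)
      consider (fin) "b c = b' c" "b d = b' d" | (left) "b c = b' c" "b k = b' k" | (right) "b d = b' d" "b k = b' k"
        using eq ba ba' fill_inf[OF ba(2) cd] fill_le[OF ba(2) cd(1)] fill_le[OF ba(2) cd(2)]
        by (auto simp: inflate_def split: if_splits)
      then have bb: "b i = b' i" if i: "i < k + 1" for i
      proof cases
        case fin
        show ?thesis by (rule transversal_design_unique[OF E ba(1) ba'(1) cd1(1,2) cd(3) fin i])
      next
        case left
        show ?thesis by (rule transversal_design_unique[OF E ba(1) ba'(1) cd1(1,3,4) left i])
      next
        case right
        show ?thesis by (rule transversal_design_unique[OF E ba(1) ba'(1) cd1(2,3,5) right i])
      qed
      have "a' \<in> fill (b k)"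
        using ba'(2) bb[of k] by simp
      then have "a e = a' e"
        using fill_unique[OF ba(2) _ cd ac ad e] by blast
      then show ?thesis
        using ba(3) ba'(3) bb[of e] bb[of k] e by (simp add: inflate_def)
    next
      case I
      then obtain w w' where w: "w \<in> W" "w' \<in> W" "f = (\<lambda>c. Inr (w c))" "f' = (\<lambda>c. Inr (w' c))"
        by blast
      then have "w c = w' c" "w d = w' d"
        using eq by simp_all
      then have "w e = w' e"
        using transversal_design_unique[OF W w(1,2) cd _ _ e] by blast
      then show ?thesis
        using w(3,4) by simp
    qed
  qed
  moreover have "card ?X = t * m + u" by (subst card_Un_disjoint) (auto simp: card_image)
  ultimately show ?thesis by (intro td_orderI) auto
qed

section \<open>Quasi-difference families\<close>

text \<open>
  The residues modulo \<open>v\<close> are the points below \<open>v\<close>; the points from \<open>v\<close> on are at infinity and fixed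
  by translation.
\<close>
definition shift :: "nat \<Rightarrow> nat \<Rightarrow> nat \<Rightarrow> nat" where
  "shift v g x = (if x < v then (x + g) mod v else x)"

text \<open>
  The orbit of a pair of points under translation, encoded as a number: \<open>v\<close> pure differences, then
  \<open>u\<close> orbits with the second point \<open>v, \<dots>, v + u - 1\<close> at infinity, then \<open>u\<close> orbits with the
  first point at infinity. The last value collects the pairs with both points at infinity.
\<close>
definition difference :: "nat \<Rightarrow> nat \<Rightarrow> nat \<Rightarrow> nat \<Rightarrow> nat" where
  "difference v u x y =
     (if x < v then if y < v then (y + v - x) mod v else y
      else if y < v then u + x else v + 2 * u)"

lemma shift_less_iff: "shift v g x < v \<longleftrightarrow> x < v"
  by (simp add: shift_def)

lemma difference_shift: "difference v u (shift v g x) (shift v g y) = difference v u x y"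
proof (cases "x < v \<and> y < v")
  case True
  then have "v > 0" by simp
  have "(x + g) mod v \<le> (y + g) mod v + v"
    using mod_less_divisor[OF \<open>v > 0\<close>, of "x + g"] by linarith
  then have "int (((y + g) mod v + v - (x + g) mod v) mod v)
      = ((int y + int g) mod int v + int v - (int x + int g) mod int v) mod int v"
    by (simp only: zmod_int of_nat_diff of_nat_add)
  also have "\<dots> = (((int y + int g) mod int v - (int x + int g) mod int v) + int v) mod int v"
    by (simp only: algebra_simps)
  also have "\<dots> = (int y + int v - int x) mod int v"
    unfolding mod_add_self2 mod_diff_eq
    using mod_add_self2[of "int y - int x" "int v"] by (simp add: algebra_simps)
  also have "\<dots> = int ((y + v - x) mod v)"
    using True by (simp add: zmod_int of_nat_diff)
  finally have "((y + g) mod v + v - (x + g) mod v) mod v = (y + v - x) mod v"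
    by simp
  then show ?thesis
    using True by (simp add: difference_def shift_def)
qed (auto simp: difference_def shift_def)

text \<open>
  The converse of \<open>difference_shift\<close>: unless both points are at infinity, the number identifies the
  orbit.
\<close>
lemma difference_eq_shiftE:
  assumes eq: "difference v u x y = difference v u x' y'" and less: "difference v u x y < v + 2 * u"
    and le: "x < v + u" "x' < v + u" "y < v + u" "y' < v + u"
  obtains g where "g < v" "shift v g x = x'" "shift v g y = y'"
proof -
  have mod_lt: "(a + v - b) mod v < v" if "b < v" for a b :: nat
    using that by simp
  have sh: "(a + (b + v - a) mod v) mod v = b" if "a < v" "b < v" for a b :: nat
  proof -
    have "(a + (b + v - a) mod v) mod v = (a + (b + v - a)) mod v"
      by (simp add: mod_simps)
    also have "\<dots> = b" using that by simp
    finally show ?thesis .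
  qed
  consider (fin) "x < v" "y < v" | (left) "x < v" "v \<le> y" | (right) "v \<le> x" "y < v"
    using less by (force simp: difference_def)
  then show ?thesis
  proof cases
    case fin
    have f': "x' < v" "y' < v" "(y + v - x) mod v = (y' + v - x') mod v"
      using eq fin mod_lt[of x y] le by (auto simp: difference_def split: if_splits)
    define g where "g = (x' + v - x) mod v"
    have "(y + g) mod v = (x + (y + v - x) mod v + (x' + v - x)) mod v"
      using fin sh[of x y] by (metis g_def mod_add_left_eq mod_add_right_eq mod_add_eq)
    also have "\<dots> = (x + (y' + v - x') mod v + (x' + v - x)) mod v"
      using f' by simp
    also have "\<dots> = (x + (y' + v - x') + (x' + v - x)) mod v"
      by (metis mod_add_left_eq mod_add_right_eq)
    also have "x + (y' + v - x') + (x' + v - x) = y' + v + v"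
      using fin f' by simp
    also have "(y' + v + v) mod v = y'"
      using f' by simp
    finally have "shift v g y = y'"
      using fin by (simp add: shift_def)
    moreover have "shift v g x = x'"
      using sh[of x x'] fin f' by (simp add: shift_def g_def)
    moreover have "g < v"
      using fin by (simp add: g_def)
    ultimately show ?thesis using that by blast
  next
    case left
    have "\<not> v \<le> (y' + v - x') mod v" if "x' < v"
      using mod_lt[OF that, of y'] by linarith
    with left have "x' < v \<and> y' = y"
      using eq le by (cases "x' < v"; cases "y' < v") (auto simp: difference_def)
    then show ?thesis
      using that[of "(x' + v - x) mod v"] left sh[of x x'] by (simp add: shift_def)
  next
    case right
    have "u + x \<noteq> (y' + v - x') mod v" if "x' < v"
      using mod_lt[OF that, of y'] right by linarith
    with right have "y' < v \<and> x' = x"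
      using eq le by (cases "x' < v"; cases "y' < v") (auto simp: difference_def)
    then show ?thesis
      using that[of "(y' + v - y) mod v"] right sh[of y y'] by (simp add: shift_def)
  qed
qed

text \<open>
  As there are only \<open>v + 2u\<close> base blocks, covering each of the \<open>v + 2u\<close> orbits in two given
  groups means covering it exactly once, and leaves no base block with two points at infinity.
\<close>
definition quasi_difference_family :: "nat \<Rightarrow> nat \<Rightarrow> nat \<Rightarrow> nat list list \<Rightarrow> bool" where
  "quasi_difference_family k v u L \<longleftrightarrow>
     length L = v + 2 * u \<and> (\<forall>b\<in>set L. length b = k \<and> (\<forall>x\<in>set b. x < v + u)) \<and>
     (\<forall>c<k. \<forall>d<k. c \<noteq> d \<longrightarrow>
        {..<v + 2 * u} \<subseteq> set (map (\<lambda>b. difference v u (b ! c) (b ! d)) L))"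

text \<open>
  The translates of the base blocks contain each pair with a finite point exactly once, since its
  orbit comes from one base block and the finite point fixes the translation. The pairs at
  infinity are left to a design of order \<open>u\<close>.
\<close>
lemma td_order_quasi_difference_family:
  assumes L: "quasi_difference_family k v u L" and u: "td_order k u" and v: "v > 0"
  shows "td_order k (v + u)"
proof -
  obtain W where W: "transversal_design k {v..<v + u} W"
    using td_orderE[OF u, of "{v..<v + u}"] by auto
  let ?diff = "\<lambda>c d b. difference v u (b ! c) (b ! d)"
  let ?dev = "\<lambda>(b, g) c. shift v g (b ! c)"
  let ?D = "?dev ` (set L \<times> {..<v})"
  have point: "b ! c < v + u" if "b \<in> set L" "c < k" for b c
    using L that by (auto simp: quasi_difference_family_def)
  have image: "?diff c d ` set L = {..<v + 2 * u}" and inj: "inj_on (?diff c d) (set L)"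
    if "c < k" "d < k" "c \<noteq> d" for c d
  proof -
    have sub: "{..<v + 2 * u} \<subseteq> ?diff c d ` set L" and len: "length L = v + 2 * u"
      using L that by (simp_all add: quasi_difference_family_def)
    have "card (?diff c d ` set L) \<le> card (set L)" "card (set L) \<le> v + 2 * u"
      using card_image_le card_length[of L] len by auto
    moreover have "v + 2 * u \<le> card (?diff c d ` set L)"
      using card_mono[OF _ sub] by simp
    ultimately show "?diff c d ` set L = {..<v + 2 * u}" "inj_on (?diff c d) (set L)"
      using card_subset_eq[OF _ sub] by (auto intro: eq_card_imp_inj_on)
  qed
  have not_both_infinite: "f c < v \<or> f d < v"
    if f: "f \<in> ?D" and cd: "c < k" "d < k" "c \<noteq> d" for f c d
  proof -
    obtain b g where "b \<in> set L" "f = ?dev (b, g)" using f by blast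
    then show ?thesis
      using image[OF cd] by (force simp: shift_less_iff difference_def)
  qed
  have W_inf: "v \<le> w c" if "w \<in> W" "c < k" for w c
    using transversal_design_point[OF W that] by simp
  have "transversal_design k {..<v + u} (?D \<union> W)"
  proof (rule transversal_designI)
    fix f c assume f: "f \<in> ?D \<union> W" and c: "c < k"
    show "f c \<in> {..<v + u}"
    proof (cases "f \<in> W")
      case True
      then show ?thesis using transversal_design_point[OF W True c] by simp
    next
      case False
      then obtain b g where "b \<in> set L" "f = ?dev (b, g)" using f by blast
      then show ?thesis
        using point[OF _ c, of b] v by (auto simp: shift_def trans_less_add1)
    qed
  next
    fix c d x y
    assume cd: "c < k" "d < k" "c \<noteq> d" and xy: "x \<in> {..<v + u}" "y \<in> {..<v + u}"
    show "\<exists>f\<in>?D \<union> W. f c = x \<and> f d = y"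
    proof (cases "x < v \<or> y < v")
      case True
      then have less: "difference v u x y < v + 2 * u"
        using xy by (auto simp: difference_def intro: trans_less_add1)
      then have "difference v u x y \<in> ?diff c d ` set L"
        using image[OF cd] by simp
      then obtain b where b: "b \<in> set L" "difference v u x y = ?diff c d b"
        by blast
      have bounds: "b ! c < v + u" "x < v + u" "b ! d < v + u" "y < v + u"
        using point[OF b(1)] cd xy by simp_all
      obtain g where "g < v" "shift v g (b ! c) = x" "shift v g (b ! d) = y"
        using difference_eq_shiftE[OF b(2)[symmetric] less[unfolded b(2)] bounds] by blast
      then show ?thesis
        using b by (intro bexI[of _ "?dev (b, g)"]) auto
    next
      case False
      then show ?thesis
        using transversal_design_joining_block[OF W cd, of x y] xy by auto
    qed
  next
    fix f f' c d e
    assume f: "f \<in> ?D \<union> W" "f' \<in> ?D \<union> W" and cd: "c < k" "d < k" "c \<noteq> d"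
      and eq: "f c = f' c" "f d = f' d" and e: "e < k"
    consider (D) "f \<in> ?D" "f' \<in> ?D" | (W) "f \<in> W" "f' \<in> W"
    proof (cases "f c < v \<or> f d < v")
      case True
      then have "f \<notin> W" "f' \<notin> W"
        using W_inf[of f c] W_inf[of f d] W_inf[of f' c] W_inf[of f' d] cd eq by auto
      then show ?thesis using f D by blast
    next
      case False
      have "f \<notin> ?D"
        using not_both_infinite[OF _ cd, of f] False by blast
      moreover have "f' \<notin> ?D"
        using not_both_infinite[OF _ cd, of f'] False[unfolded eq] by blast
      ultimately show ?thesis using f W by blast
    qed
    then show "f e = f' e"
    proof cases
      case D
      obtain b g where b: "b \<in> set L" "g < v" "f = ?dev (b, g)" using D(1) by blast
      obtain b' g' where b': "b' \<in> set L" "g' < v" "f' = ?dev (b', g')" using D(2) by blast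
      have "?diff c d b = difference v u (f c) (f d)"
        by (simp add: b(3) difference_shift)
      also have "\<dots> = ?diff c d b'"
        unfolding eq by (simp add: b'(3) difference_shift)
      finally have bb: "b = b'"
        using inj[OF cd] b(1) b'(1) by (auto dest: inj_onD)
      have "g = g'" if "b ! i < v" "f i = f' i" for i
      proof -
        have "(b ! i + g) mod v = (b ! i + g') mod v"
          using that b(3) b'(3) bb by (simp add: shift_def)
        then have "int v dvd int (b ! i + g) - int (b ! i + g')"
          by (metis mod_eq_dvd_iff zmod_int)
        then show ?thesis
          using int_range_dvd_diff_eq[OF b(2) b'(2)] by simp
      qed
      moreover have "b ! c < v \<or> b ! d < v"
        using not_both_infinite[OF D(1) cd] b(3) by (simp add: shift_less_iff)
      ultimately have "g = g'" using eq by blast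
      then show ?thesis using b(3) b'(3) bb by simp
    next
      case W
      then show ?thesis
        using transversal_design_unique[OF \<open>transversal_design k {v..<v + u} W\<close> W cd eq e] by blast
    qed
  qed
  then show ?thesis
    by (rule td_orderI) auto
qed

text \<open>
  The Klein four-group permutes the four groups regularly. A family invariant under it has the same
  differences in the groups 0 and 1 as in 1 and 0, in 2 and 3 and in 3 and 2, and similarly for the
  other pairs. This symmetry makes base blocks easy to find: beside the zero block there are
  \<open>u\<close> orbits with a point at infinity and \<open>(v - 2u - 1)/4\<close> finite ones.
\<close>
fun klein_orbit :: "'a list \<Rightarrow> 'a list list" where
  "klein_orbit [a, b, c, d] = [[a, b, c, d], [b, a, d, c], [c, d, a, b], [d, c, b, a]]"
| "klein_orbit _ = []"

section \<open>The orders of transversal designs with four groups\<close>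

lemma td_order_4: "td_order 4 4"
proof -
  have "quasi_difference_family 4 3 1 ([0, 0, 0, 0] # concat (map klein_orbit [[0, 1, 2, 3]]))"
    by code_simp
  from td_order_quasi_difference_family[OF this td_order_odd] show ?thesis by simp
qed

lemma td_order_8: "td_order 4 8"
proof -
  have "quasi_difference_family 4 7 1
    ([0, 0, 0, 0] # concat (map klein_orbit [[0, 1, 3, 7], [0, 2, 1, 4]]))"
    by code_simp
  from td_order_quasi_difference_family[OF this td_order_odd] show ?thesis by simp
qed

text \<open>
  The base blocks of Bose, Shrikhande and Parker consist of \<open>0, i, -i\<close> and the \<open>i\<close>-th point at infinity.
\<close>
lemma td_order_10: "td_order 4 10"
proof -
  have "quasi_difference_family 4 7 3
    ([0, 0, 0, 0] # concat (map klein_orbit [[0, 1, 6, 7], [0, 2, 5, 8], [0, 3, 4, 9]]))"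
    by code_simp
  from td_order_quasi_difference_family[OF this td_order_odd] show ?thesis by simp
qed

lemma td_order_14: "td_order 4 14"
proof -
  have "quasi_difference_family 4 11 3
    ([0, 0, 0, 0] # concat (map klein_orbit
       [[0, 1, 2, 11], [0, 2, 5, 12], [0, 5, 7, 13], [0, 3, 8, 4]]))"
    by code_simp
  from td_order_quasi_difference_family[OF this td_order_odd] show ?thesis by simp
qed

text \<open>
  Wilson's construction with \<open>m = 3\<close>: the number \<open>u = n - 3t\<close> of points at infinity is odd, so the affine
  design is available for it.
\<close>
lemma td_order_even_wilson:
  assumes n: "even n" and t: "coprime t 6" "3 * t \<le> n" "n \<le> 4 * t"
  shows "td_order 4 n"
proof -
  have "odd t"
    using t(1) coprime_mult_right_iff[of t 2 3] by simp
  then have "odd (n - t * 3)"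
    using n t(2) by simp
  have "td_order 4 (t * 3 + (n - t * 3))"
    using t td_order_5_coprime_6[OF t(1)] td_order_4 td_order_odd[of 3] td_order_odd[OF \<open>odd (n - t * 3)\<close>]
    by (intro td_order_wilson) simp_all
  then show ?thesis
    using t(2) by simp
qed

text \<open>
  Among any four consecutive numbers one is coprime to 6; from 45 on, four consecutive
  numbers starting at \<open>\<lceil>n/4\<rceil>\<close> do not exceed \<open>n/3\<close>.
\<close>
lemma ex_coprime_6_between:
  fixes n :: nat
  assumes "45 \<le> n"
  obtains t where "coprime t 6" "3 * t \<le> n" "n \<le> 4 * t"
proof -
  define m where "m = (n + 3) div 4"
  have m: "n \<le> 4 * m" "4 * m \<le> n + 3"
    unfolding m_def by linarith+
  have "\<exists>j\<le>3. (m + j) mod 6 = 1 \<or> (m + j) mod 6 = 5"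
    by presburger
  then obtain j where j: "j \<le> 3" "(m + j) mod 6 = 1 \<or> (m + j) mod 6 = 5"
    by blast
  have "coprime (5::nat) 6"
    using coprime_Suc_right_nat[of 5] by simp
  then have "coprime ((m + j) mod 6) 6"
    using j(2) by (elim disjE) (simp_all only: coprime_1_left)
  then have "coprime (m + j) 6"
    by simp
  moreover have "3 * (m + j) \<le> n"
    using m(2) j(1) assms by simp
  moreover have "n \<le> 4 * (m + j)"
    using m(1) by simp
  ultimately show ?thesis
    using that by blast
qed

lemma td_order_4_all:
  assumes "n > 0" "n \<noteq> 2" "n \<noteq> 6"
  shows "td_order 4 n"
proof (cases "even n")
  case False
  then show ?thesis by (rule td_order_odd)
next
  case True
  have 5: "coprime (5::nat) 6" and 7: "coprime (7::nat) 6"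
    using coprime_Suc_right_nat[of 5] coprime_Suc_left_nat[of 6] by simp_all
  have "coprime (11 mod 6 :: nat) 6"
    using 5 by simp
  then have 11: "coprime (11::nat) 6"
    by (simp only: coprime_mod_left_iff)
  have "45 \<le> n \<or> 15 \<le> n \<and> n \<le> 20 \<or> 21 \<le> n \<and> n \<le> 28 \<or> 33 \<le> n \<and> n \<le> 44 \<or>
      n \<in> {4, 8, 10, 12, 14, 30, 32}"
    using True assms by simp presburger
  then consider "45 \<le> n" | "15 \<le> n" "n \<le> 20" | "21 \<le> n" "n \<le> 28" | "33 \<le> n" "n \<le> 44"
    | "n = 4" | "n = 8" | "n = 10" | "n = 12" | "n = 14" | "n = 30" | "n = 32"
    by blast
  then show ?thesis
  proof cases
    case 1
    then show ?thesis using ex_coprime_6_between td_order_even_wilson[OF True] by metis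
  next
    case 2
    then show ?thesis using td_order_even_wilson[OF True 5] by simp
  next
    case 3
    then show ?thesis using td_order_even_wilson[OF True 7] by simp
  next
    case 4
    then show ?thesis using td_order_even_wilson[OF True 11] by simp
  next
    case 8
    then show ?thesis using td_order_mult[OF td_order_odd[of 3] td_order_4] by simp
  next
    case 10
    then show ?thesis using td_order_mult[OF td_order_odd[of 3] td_order_10] by simp
  next
    case 11
    then show ?thesis using td_order_mult[OF td_order_4 td_order_8] by simp
  qed (simp_all add: td_order_4 td_order_8 td_order_10 td_order_14)
qed

section \<open>Renaming symbols and numbering cells\<close>

lemma latin_tradeD:
  assumes "latin_trade \<mu> n S T" and r: "r < \<mu>"
  shows "partial_latin_square n S (T r)"
    and "q < \<mu> \<Longrightarrow> dom (T r) = dom (T q)"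
    and "q < \<mu> \<Longrightarrow> r \<noteq> q \<Longrightarrow> c \<in> dom (T r) \<Longrightarrow> T r c \<noteq> T q c"
    and "q < \<mu> \<Longrightarrow> i < n \<Longrightarrow> row_symbols (T r) i = row_symbols (T q) i"
    and "q < \<mu> \<Longrightarrow> i < n \<Longrightarrow> col_symbols (T r) i = col_symbols (T q) i"
proof -
  note T = assms(1)[unfolded latin_trade_def]
  show "partial_latin_square n S (T r)"
    by (rule T[THEN conjunct1, rule_format, OF r])
  show "q < \<mu> \<Longrightarrow> dom (T r) = dom (T q)"
    by (rule T[THEN conjunct2, THEN conjunct1, rule_format, OF r])
  show "q < \<mu> \<Longrightarrow> r \<noteq> q \<Longrightarrow> c \<in> dom (T r) \<Longrightarrow> T r c \<noteq> T q c"
    by (rule T[THEN conjunct2, THEN conjunct2, THEN conjunct1, rule_format, OF r])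
  show "q < \<mu> \<Longrightarrow> i < n \<Longrightarrow> row_symbols (T r) i = row_symbols (T q) i"
    by (rule T[THEN conjunct2, THEN conjunct2, THEN conjunct2, THEN conjunct1, rule_format, OF r])
  show "q < \<mu> \<Longrightarrow> i < n \<Longrightarrow> col_symbols (T r) i = col_symbols (T q) i"
    by (rule T[THEN conjunct2, THEN conjunct2, THEN conjunct2, THEN conjunct2, rule_format, OF r])
qed

lemma homogeneous_latin_trade_relabel:
  assumes T: "homogeneous_latin_trade \<mu> k m S T" and f: "bij_betw f S S'"
  shows "homogeneous_latin_trade \<mu> k m S' (\<lambda>r c. map_option f (T r c))"
proof -
  let ?T = "\<lambda>r c. map_option f (T r c)"
  have inj: "inj_on f S" and S': "S' = f ` S"
    using f by (simp_all add: bij_betw_def)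
  have lt: "latin_trade \<mu> m S T"
    using T by (simp add: homogeneous_latin_trade_def)
  have pls: "partial_latin_square m S (T r)" if "r < \<mu>" for r
    by (rule latin_tradeD(1)[OF lt that])
  have dom: "dom (?T r) = dom (T r)" for r
    by (auto simp: dom_def)
  have entry: "s \<in> S" if "T r c = Some s" "r < \<mu>" for r c s
    using pls[OF that(2)] that(1) by (auto simp: partial_latin_square_def intro: ranI)
  have same: "s = s'" if "T r c = Some s" "T q c' = Some s'" "f s = f s'" "r < \<mu>" "q < \<mu>"
    for r q c c' s s'
    using inj entry[OF that(1,4)] entry[OF that(2,5)] that(3) by (auto dest: inj_onD)
  have pls': "partial_latin_square m S' (?T r)" if r: "r < \<mu>" for r
    unfolding partial_latin_square_def
  proof (intro conjI allI impI)
    show "finite S'"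
      using pls[OF r] S' by (simp add: partial_latin_square_def)
    show "dom (?T r) \<subseteq> {..<m} \<times> {..<m}"
      unfolding dom using pls[OF r] by (simp add: partial_latin_square_def)
    show "ran (?T r) \<subseteq> S'"
      using entry[OF _ r] S' by (auto simp: ran_def)
  next
    fix i j j' s assume "?T r (i, j) = Some s \<and> ?T r (i, j') = Some s"
    then obtain a a' where a: "T r (i, j) = Some a" "T r (i, j') = Some a'" "f a = f a'" by auto
    then have "T r (i, j') = Some a" using same[OF a r r] by simp
    then show "j = j'"
      using pls[OF r] a(1) by (simp add: partial_latin_square_def) blast
  next
    fix i i' j s assume "?T r (i, j) = Some s \<and> ?T r (i', j) = Some s"
    then obtain a a' where a: "T r (i, j) = Some a" "T r (i', j) = Some a'" "f a = f a'" by auto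
    then have "T r (i', j) = Some a" using same[OF a r r] by simp
    then show "i = i'"
      using pls[OF r] a(1) by (simp add: partial_latin_square_def) blast
  qed
  have distinct: "?T r c \<noteq> ?T q c" if rq: "r < \<mu>" "q < \<mu>" "r \<noteq> q" and c: "c \<in> dom (?T r)" for r q c
  proof
    assume eq: "?T r c = ?T q c"
    obtain a where a: "T r c = Some a" using c dom by blast
    then obtain a' where a': "T q c = Some a'" "f a = f a'" using eq by (cases "T q c") auto
    have "T r c = T q c" using same[OF a a'(1,2) rq(1,2)] a a'(1) by simp
    moreover have "T r c \<noteq> T q c"
      using latin_tradeD(3)[OF lt rq] c unfolding dom .
    ultimately show False by contradiction
  qed
  have row: "row_symbols (?T r) i = f ` row_symbols (T r) i"
    and col: "col_symbols (?T r) i = f ` col_symbols (T r) i" for r i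
    by (auto simp: row_symbols_def col_symbols_def image_iff)
  have "latin_trade \<mu> m S' ?T"
    unfolding latin_trade_def row col
  proof (intro conjI allI impI ballI)
    fix r q c assume "r < \<mu>" "q < \<mu>" "r \<noteq> q" "c \<in> dom (?T r)"
    then show "?T r c \<noteq> ?T q c" by (rule distinct)
  next
    fix r q assume rq: "r < \<mu>" "q < \<mu>"
    show "dom (?T r) = dom (?T q)"
      unfolding dom by (rule latin_tradeD(2)[OF lt rq])
    fix i assume i: "i < m"
    show "f ` row_symbols (T r) i = f ` row_symbols (T q) i"
      by (simp only: latin_tradeD(4)[OF lt rq i])
    show "f ` col_symbols (T r) i = f ` col_symbols (T q) i"
      by (simp only: latin_tradeD(5)[OF lt rq i])
  qed (rule pls')
  moreover have "card {c. ?T r c = Some s'} = k" if r: "r < \<mu>" and s': "s' \<in> S'" for r s'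
  proof -
    obtain s where s: "s \<in> S" "s' = f s" using s' S' by blast
    have "{c. ?T r c = Some s'} = {c. T r c = Some s}"
      using s inj entry[OF _ r] by (auto dest: inj_onD)
    then show ?thesis
      using T r s(1) by (simp add: homogeneous_latin_trade_def)
  qed
  ultimately show ?thesis
    using T unfolding homogeneous_latin_trade_def dom
    by (simp add: S' card_image[OF inj])
qed

text \<open>The given trades may use unrelated symbol sets; they have to share one before they are copied.\<close>
lemma homogeneous_latin_trade_standard_symbols:
  assumes "homogeneous_latin_trade \<mu> k m S T"
  obtains T' where "homogeneous_latin_trade \<mu> k m {..<m} T'"
proof -
  have "finite S" "card S = m"
    using assms by (simp_all add: homogeneous_latin_trade_def)
  then obtain f where "bij_betw f S {..<m}"
    using finite_same_card_bij[of S "{..<m}"] by auto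
  then show ?thesis
    using that homogeneous_latin_trade_relabel[OF assms] by blast
qed

lemma digits_eq_iff:
  fixes a a' x x' p :: nat
  assumes "x < p" "x' < p"
  shows "a * p + x = a' * p + x' \<longleftrightarrow> a = a' \<and> x = x'"
proof
  assume eq: "a * p + x = a' * p + x'"
  have "(a * p + x) div p = a" "(a' * p + x') div p = a'" "(a * p + x) mod p = x" "(a' * p + x') mod p = x'"
    using assms by simp_all
  then show "a = a' \<and> x = x'" using eq by metis
qed simp

lemma digits_less:
  fixes a x l p :: nat
  assumes "a < l" "x < p"
  shows "a * p + x < l * p"
proof -
  have "a * p + x < Suc a * p" using assms(2) by simp
  also have "\<dots> \<le> l * p" using assms(1) by (intro mult_le_mono1) simp
  finally show ?thesis .
qed

lemma digitsE:
  fixes n :: nat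
  assumes "n < l * p"
  obtains a x where "a < l" "x < p" "n = a * p + x"
proof
  show "n div p < l" using assms by (rule less_mult_imp_div_less)
  show "n mod p < p" using assms by (cases "p = 0") auto
  show "n = n div p * p + n mod p" by simp
qed

lemma card_UN_image:
  assumes "finite Q" "\<And>q. q \<in> Q \<Longrightarrow> finite (A q)"
    and inj: "\<And>q q' a a'. q \<in> Q \<Longrightarrow> q' \<in> Q \<Longrightarrow> a \<in> A q \<Longrightarrow> a' \<in> A q' \<Longrightarrow> h q a = h q' a' \<Longrightarrow>
      q = q' \<and> a = a'"
  shows "card (\<Union>q\<in>Q. h q ` A q) = (\<Sum>q\<in>Q. card (A q))"
proof -
  have "(\<Union>q\<in>Q. h q ` A q) = (\<lambda>(q, a). h q a) ` Sigma Q A"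
    by (auto simp: image_iff)
  moreover have "inj_on (\<lambda>(q, a). h q a) (Sigma Q A)"
    using inj by (auto intro!: inj_onI)
  ultimately show ?thesis
    using assms(1,2) by (simp add: card_image)
qed

section \<open>Blowing up a transversal design\<close>

text \<open>
  The coordinates of a block of the design are its row block, its column block, its symbol set and the
  index of the trade placed there. The first two determine the others, so the result does
  not depend on the choice of \<open>b\<close>.
\<close>
definition blow_up ::
    "nat \<Rightarrow> nat \<Rightarrow> (nat \<Rightarrow> nat) set \<Rightarrow> (nat \<Rightarrow> nat \<Rightarrow> nat parray) \<Rightarrow> nat \<Rightarrow> nat parray" where
  "blow_up p l B T r = (\<lambda>(i, j).
     if i < l * p \<and> j < l * p then
       let b = (SOME b. b \<in> B \<and> b 0 = i div p \<and> b 1 = j div p)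
       in map_option (\<lambda>s. b 2 * p + s) (T (b 3) r (i mod p, j mod p))
     else None)"

text \<open>
  Everything follows from the relational description \<open>U_Some_iff\<close>, which treats rows, columns and
  symbols alike. Each regularity count fixes one of the coordinates 0, 1, 2 of the design and
  sorts the cells by coordinate 3: for each \<open>q\<close> there is exactly one block with the fixed
  coordinate and with last coordinate \<open>q\<close>, and it contributes \<open>k q\<close>.
\<close>
lemma homogeneous_latin_trade_blow_up:
  assumes B: "transversal_design 4 {..<l} B"
    and T: "\<And>q. q < l \<Longrightarrow> homogeneous_latin_trade \<mu> (k q) p {..<p} (T q)"
  shows "homogeneous_latin_trade \<mu> (\<Sum>q<l. k q) (l * p) {..<l * p} (blow_up p l B T)"
proof -
  let ?U = "blow_up p l B T"
  have lt: "latin_trade \<mu> p {..<p} (T q)" if "q < l" for q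
    using T[OF that] by (simp add: homogeneous_latin_trade_def)
  have pls: "partial_latin_square p {..<p} (T q r)" if "q < l" "r < \<mu>" for q r
    by (rule latin_tradeD(1)[OF lt[OF that(1)] that(2)])
  have bound: "x < p" "y < p" "s < p" if "q < l" "r < \<mu>" "T q r (x, y) = Some s" for q r x y s
    using pls[OF that(1,2)] that(3) by (auto simp: partial_latin_square_def dom_def ran_def)
  have row_inj: "y = y'"
    if "q < l" "r < \<mu>" "T q r (x, y) = Some s" "T q r (x, y') = Some s" for q r x y y' s
    using pls[OF that(1,2)] that(3,4) unfolding partial_latin_square_def by blast
  have col_inj: "x = x'"
    if "q < l" "r < \<mu>" "T q r (x, y) = Some s" "T q r (x', y) = Some s" for q r x x' y s
    using pls[OF that(1,2)] that(3,4) unfolding partial_latin_square_def by blast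
  have pt: "b c < l" if "b \<in> B" "c < 4" for b c
    using transversal_design_point[OF B that] by simp
  note same_block = transversal_design_unique[OF B]
  have block: "\<exists>b\<in>B. b c = x \<and> b d = y" if "c < 4" "d < 4" "c \<noteq> d" "x < l" "y < l" for c d x y
    using transversal_design_joining_block[OF B that(1-3)] that(4,5) by simp

  \<comment> \<open>This eliminates the choice in \<open>blow_up\<close> and puts rows, columns and symbols on the same footing.\<close>
  have U_Some_iff: "?U r (i, j) = Some s \<longleftrightarrow>
      (\<exists>b\<in>B. \<exists>x y z. T (b 3) r (x, y) = Some z \<and>
         i = b 0 * p + x \<and> j = b 1 * p + y \<and> s = b 2 * p + z)"
    (is "?L \<longleftrightarrow> ?R") if r: "r < \<mu>" for r i j s
  proof
    assume ?L
    then have ij: "i < l * p" "j < l * p" by (auto simp: blow_up_def split: if_splits)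
    define b where "b = (SOME b. b \<in> B \<and> b 0 = i div p \<and> b 1 = j div p)"
    have "\<exists>b. b \<in> B \<and> b 0 = i div p \<and> b 1 = j div p"
      using block[of 0 1 "i div p" "j div p"] ij by (auto simp: less_mult_imp_div_less)
    then have b: "b \<in> B" "b 0 = i div p" "b 1 = j div p"
      unfolding b_def by (metis (mono_tags, lifting) someI_ex)+
    obtain z where "T (b 3) r (i mod p, j mod p) = Some z" "s = b 2 * p + z"
      using \<open>?L\<close> ij by (auto simp: blow_up_def b_def[symmetric] Let_def simp del: One_nat_def)
    then show ?R
      using b by (intro bexI[of _ b] exI[of _ "i mod p"] exI[of _ "j mod p"] exI[of _ z]) simp_all
  next
    assume ?R
    then obtain b x y z where b: "b \<in> B" and z: "T (b 3) r (x, y) = Some z"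
        and eq: "i = b 0 * p + x" "j = b 1 * p + y" "s = b 2 * p + z"
      by blast
    have xy: "x < p" "y < p"
      using bound[OF pt[OF b] r z] by simp_all
    have ij: "i < l * p" "j < l * p"
      using eq xy pt[OF b] by (simp_all add: digits_less)
    have div: "i div p = b 0" "j div p = b 1" "i mod p = x" "j mod p = y"
      using eq xy by simp_all
    define b' where "b' = (SOME b'. b' \<in> B \<and> b' 0 = i div p \<and> b' 1 = j div p)"
    have "b' \<in> B \<and> b' 0 = i div p \<and> b' 1 = j div p"
      unfolding b'_def by (rule someI[of _ b]) (simp only: b div simp_thms)
    then have "b' e = b e" if "e < 4" for e
      using same_block[OF _ b, of b' 0 1 e] that div by simp
    then have "b' 2 = b 2" "b' 3 = b 3" by simp_all
    moreover have "?U r (i, j) = map_option (\<lambda>s. b' 2 * p + s) (T (b' 3) r (i mod p, j mod p))"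
      by (simp only: blow_up_def b'_def Let_def prod.case ij simp_thms if_True)
    ultimately show ?L
      using z eq(3) div by simp
  qed
  have dom_iff: "(i, j) \<in> dom (?U r) \<longleftrightarrow>
      (\<exists>b\<in>B. \<exists>x y. (x, y) \<in> dom (T (b 3) r) \<and> i = b 0 * p + x \<and> j = b 1 * p + y)"
    if "r < \<mu>" for r i j
    unfolding domIff option.collapse[symmetric] not_None_eq U_Some_iff[OF that] by blast
  have U_pls: "partial_latin_square (l * p) {..<l * p} (?U r)" if r: "r < \<mu>" for r
    unfolding partial_latin_square_def
  proof (intro conjI allI impI)
    have *: "i < l * p \<and> j < l * p \<and> s < l * p" if "?U r (i, j) = Some s" for i j s
    proof -
      obtain b x y z where b: "b \<in> B" and z: "T (b 3) r (x, y) = Some z"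
        and eq: "i = b 0 * p + x" "j = b 1 * p + y" "s = b 2 * p + z"
        using \<open>?U r (i, j) = Some s\<close> U_Some_iff[OF r] by blast
      then show ?thesis
        using bound[OF pt[OF b] r z] pt[OF b] by (simp add: digits_less)
    qed
    show "dom (?U r) \<subseteq> {..<l * p} \<times> {..<l * p}" "ran (?U r) \<subseteq> {..<l * p}"
      using * by (auto simp: dom_def ran_def)
  next
    fix i j j' s assume "?U r (i, j) = Some s \<and> ?U r (i, j') = Some s"
    then obtain b x y z b' x' y' z' where b: "b \<in> B" "b' \<in> B"
      and z: "T (b 3) r (x, y) = Some z" "T (b' 3) r (x', y') = Some z'"
      and eq: "i = b 0 * p + x" "j = b 1 * p + y" "s = b 2 * p + z"
        "i = b' 0 * p + x'" "j' = b' 1 * p + y'" "s = b' 2 * p + z'"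
      unfolding U_Some_iff[OF r] by blast
    have q: "b 3 < l" "b' 3 < l" using pt b by simp_all
    have "b 0 = b' 0 \<and> x = x'" "b 2 = b' 2 \<and> z = z'"
      using eq bound[OF q(1) r z(1)] bound[OF q(2) r z(2)] by (metis digits_eq_iff)+
    then have "b 1 = b' 1" "b 3 = b' 3" "x = x'" "z = z'"
      using same_block[OF b, of 0 2 1] same_block[OF b, of 0 2 3] by simp_all
    then show "j = j'"
      using row_inj[OF q(1) r z(1), of y'] z(2) eq by simp
  next
    fix i i' j s assume "?U r (i, j) = Some s \<and> ?U r (i', j) = Some s"
    then obtain b x y z b' x' y' z' where b: "b \<in> B" "b' \<in> B"
      and z: "T (b 3) r (x, y) = Some z" "T (b' 3) r (x', y') = Some z'"
      and eq: "i = b 0 * p + x" "j = b 1 * p + y" "s = b 2 * p + z"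
        "i' = b' 0 * p + x'" "j = b' 1 * p + y'" "s = b' 2 * p + z'"
      unfolding U_Some_iff[OF r] by blast
    have q: "b 3 < l" "b' 3 < l" using pt b by simp_all
    have "b 1 = b' 1 \<and> y = y'" "b 2 = b' 2 \<and> z = z'"
      using eq bound[OF q(1) r z(1)] bound[OF q(2) r z(2)] by (metis digits_eq_iff)+
    then have "b 0 = b' 0" "b 3 = b' 3" "y = y'" "z = z'"
      using same_block[OF b, of 1 2 0] same_block[OF b, of 1 2 3] by simp_all
    then show "i = i'"
      using col_inj[OF q(1) r z(1), of x'] z(2) eq by simp
  qed simp
  have U_dom: "dom (?U r) = dom (?U q)" if rq: "r < \<mu>" "q < \<mu>" for r q
  proof -
    have "dom (T (b 3) r) = dom (T (b 3) q)" if "b \<in> B" for b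
      using latin_tradeD(2)[OF lt rq] pt[OF that] by simp
    then have "(i, j) \<in> dom (?U r) \<longleftrightarrow> (i, j) \<in> dom (?U q)" for i j
      unfolding dom_iff[OF rq(1)] dom_iff[OF rq(2)] by auto
    then show ?thesis by (intro set_eqI) (metis surj_pair)
  qed
  have U_distinct: "?U r c \<noteq> ?U q c" if rq: "r < \<mu>" "q < \<mu>" "r \<noteq> q" and c: "c \<in> dom (?U r)" for r q c
  proof
    assume same: "?U r c = ?U q c"
    obtain i j where ij: "c = (i, j)" by (cases c)
    obtain s where "?U r (i, j) = Some s"
      using c ij by blast
    then have s: "?U r (i, j) = Some s" "?U q (i, j) = Some s"
      using same ij by simp_all
    obtain b x y z where b: "b \<in> B" and z: "T (b 3) r (x, y) = Some z"
      and eq: "i = b 0 * p + x" "j = b 1 * p + y" "s = b 2 * p + z"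
      using s(1) unfolding U_Some_iff[OF rq(1)] by blast
    obtain b' x' y' z' where b': "b' \<in> B" and z': "T (b' 3) q (x', y') = Some z'"
      and eq': "i = b' 0 * p + x'" "j = b' 1 * p + y'" "s = b' 2 * p + z'"
      using s(2) unfolding U_Some_iff[OF rq(2)] by blast
    have w: "b 3 < l" "b' 3 < l" using pt b b' by simp_all
    have "b 0 = b' 0 \<and> x = x'" "b 1 = b' 1 \<and> y = y'" "b 2 = b' 2 \<and> z = z'"
      using eq eq' bound[OF w(1) rq(1) z] bound[OF w(2) rq(2) z'] by (metis digits_eq_iff)+
    moreover from this have "b 3 = b' 3"
      using same_block[OF b b', of 0 1 3] by simp
    ultimately have "T (b 3) r (x, y) = T (b 3) q (x, y)"
      using z z' by simp
    then show False
      using latin_tradeD(3)[OF lt[OF w(1)] rq, of "(x, y)"] z by blast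
  qed
  have U_row: "row_symbols (?U r) i \<subseteq> row_symbols (?U q) i" if rq: "r < \<mu>" "q < \<mu>" for r q i
  proof
    fix s assume "s \<in> row_symbols (?U r) i"
    then obtain b x y z where b: "b \<in> B" and z: "T (b 3) r (x, y) = Some z"
      and eq: "i = b 0 * p + x" "s = b 2 * p + z"
      unfolding row_symbols_def mem_Collect_eq U_Some_iff[OF rq(1)] by blast
    have w: "b 3 < l" using pt b by simp
    have "row_symbols (T (b 3) r) x = row_symbols (T (b 3) q) x"
      using bound[OF w rq(1) z] by (intro latin_tradeD(4)[OF lt[OF w] rq])
    then obtain y' where "T (b 3) q (x, y') = Some z"
      using z by (auto simp: row_symbols_def)
    then show "s \<in> row_symbols (?U q) i"
      unfolding row_symbols_def mem_Collect_eq U_Some_iff[OF rq(2)] using b eq by blast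
  qed
  have U_col: "col_symbols (?U r) j \<subseteq> col_symbols (?U q) j" if rq: "r < \<mu>" "q < \<mu>" for r q j
  proof
    fix s assume "s \<in> col_symbols (?U r) j"
    then obtain b x y z where b: "b \<in> B" and z: "T (b 3) r (x, y) = Some z"
      and eq: "j = b 1 * p + y" "s = b 2 * p + z"
      unfolding col_symbols_def mem_Collect_eq U_Some_iff[OF rq(1)] by blast
    have w: "b 3 < l" using pt b by simp
    have "col_symbols (T (b 3) r) y = col_symbols (T (b 3) q) y"
      using bound[OF w rq(1) z] by (intro latin_tradeD(5)[OF lt[OF w] rq])
    then obtain x' where "T (b 3) q (x', y) = Some z"
      using z by (auto simp: col_symbols_def)
    then show "s \<in> col_symbols (?U q) j"
      unfolding col_symbols_def mem_Collect_eq U_Some_iff[OF rq(2)] using b eq by blast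
  qed
  have "latin_trade \<mu> (l * p) {..<l * p} ?U"
    unfolding latin_trade_def
  proof (intro conjI allI impI ballI)
    fix r q assume rq: "r < \<mu>" "q < \<mu>"
    show "dom (?U r) = dom (?U q)" by (rule U_dom[OF rq])
    show "?U r c \<noteq> ?U q c" if "r \<noteq> q" "c \<in> dom (?U r)" for c
      by (rule U_distinct[OF rq that])
    show "row_symbols (?U r) i = row_symbols (?U q) i" for i
      by (rule subset_antisym) (rule U_row; fact rq)+
    show "col_symbols (?U r) j = col_symbols (?U q) j" for j
      by (rule subset_antisym) (rule U_col; fact rq)+
  qed (rule U_pls)
  moreover have "card {j. (i, j) \<in> dom (?U r)} = (\<Sum>q<l. k q)" if r: "r < \<mu>" and i: "i < l * p" for r i
  proof -
    obtain a x where ax: "a < l" "x < p" "i = a * p + x" using digitsE[OF i] .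
    have "\<forall>q\<in>{..<l}. \<exists>b. b \<in> B \<and> b 0 = a \<and> b 3 = q"
      using block[of 0 3 a] ax(1) by auto
    then obtain blk where blk: "\<And>q. q < l \<Longrightarrow> blk q \<in> B \<and> blk q 0 = a \<and> blk q 3 = q"
      by (metis lessThan_iff)
    let ?A = "\<lambda>q. {y. (x, y) \<in> dom (T q r)}"
    have A: "?A q \<subseteq> {..<p}" if "q < l" for q
      using bound[OF that r] by auto
    have "{j. (i, j) \<in> dom (?U r)} = (\<Union>q\<in>{..<l}. (\<lambda>y. blk q 1 * p + y) ` ?A q)" (is "_ = ?R")
    proof (intro set_eqI iffI)
      fix j assume "j \<in> {j. (i, j) \<in> dom (?U r)}"
      then obtain b x' y where b: "b \<in> B" and y: "(x', y) \<in> dom (T (b 3) r)"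
        and eq: "i = b 0 * p + x'" "j = b 1 * p + y"
        unfolding mem_Collect_eq dom_iff[OF r] by blast
      have w: "b 3 < l" using pt b by simp
      have "x' < p" using bound[OF w r] y by blast
      then have "b 0 = a" "x' = x"
        using eq ax digits_eq_iff by metis+
      moreover have "blk (b 3) 1 = b 1"
        using same_block[of "blk (b 3)" b 0 3 1] blk[OF w] b \<open>b 0 = a\<close> by simp
      ultimately have "j = blk (b 3) 1 * p + y" "(x, y) \<in> dom (T (b 3) r)"
        using y eq(2) by (simp_all only:)
      then show "j \<in> ?R" using w by blast
    next
      fix j assume "j \<in> ?R"
      then obtain q y where "q < l" "(x, y) \<in> dom (T q r)" "j = blk q 1 * p + y" by blast
      then show "j \<in> {j. (i, j) \<in> dom (?U r)}"
        unfolding mem_Collect_eq dom_iff[OF r] using blk ax(3) by (intro bexI[of _ "blk q"]) auto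
    qed
    also have "card \<dots> = (\<Sum>q<l. card (?A q))"
    proof (rule card_UN_image)
      show "finite (?A q)" if "q \<in> {..<l}" for q
        using finite_subset[OF A] that by simp
      show "q = q' \<and> y = y'"
        if q: "q \<in> {..<l}" "q' \<in> {..<l}" and y: "y \<in> ?A q" "y' \<in> ?A q'"
          and eq: "blk q 1 * p + y = blk q' 1 * p + y'" for q q' y y'
      proof -
        have "y < p" "y' < p" using A q y by blast+
        then have *: "blk q 1 = blk q' 1" "y = y'" using eq digits_eq_iff by blast+
        then have "blk q 3 = blk q' 3"
          using same_block[of "blk q" "blk q'" 0 1 3] blk q by simp
        then show ?thesis using blk q * by simp
      qed
    qed simp
    also have "\<dots> = (\<Sum>q<l. k q)"
      using T r ax(2) by (intro sum.cong) (auto simp: homogeneous_latin_trade_def)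
    finally show ?thesis .
  qed
  moreover have "card {i. (i, j) \<in> dom (?U r)} = (\<Sum>q<l. k q)" if r: "r < \<mu>" and j: "j < l * p" for r j
  proof -
    obtain a y where ay: "a < l" "y < p" "j = a * p + y" using digitsE[OF j] .
    have "\<forall>q\<in>{..<l}. \<exists>b. b \<in> B \<and> b 1 = a \<and> b 3 = q"
      using block[of 1 3 a] ay(1) by auto
    then obtain blk where blk: "\<And>q. q < l \<Longrightarrow> blk q \<in> B \<and> blk q 1 = a \<and> blk q 3 = q"
      by (metis lessThan_iff)
    let ?A = "\<lambda>q. {x. (x, y) \<in> dom (T q r)}"
    have A: "?A q \<subseteq> {..<p}" if "q < l" for q
      using bound[OF that r] by auto
    have "{i. (i, j) \<in> dom (?U r)} = (\<Union>q\<in>{..<l}. (\<lambda>x. blk q 0 * p + x) ` ?A q)" (is "_ = ?R")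
    proof (intro set_eqI iffI)
      fix i assume "i \<in> {i. (i, j) \<in> dom (?U r)}"
      then obtain b x y' where b: "b \<in> B" and x: "(x, y') \<in> dom (T (b 3) r)"
        and eq: "i = b 0 * p + x" "j = b 1 * p + y'"
        unfolding mem_Collect_eq dom_iff[OF r] by blast
      have w: "b 3 < l" using pt b by simp
      have "y' < p" using bound[OF w r] x by blast
      then have "b 1 = a" "y' = y"
        using eq ay digits_eq_iff by metis+
      moreover have "blk (b 3) 0 = b 0"
        using same_block[of "blk (b 3)" b 1 3 0] blk[OF w] b \<open>b 1 = a\<close> by simp
      ultimately have "i = blk (b 3) 0 * p + x" "(x, y) \<in> dom (T (b 3) r)"
        using x eq(1) by (simp_all only:)
      then show "i \<in> ?R" using w by blast
    next
      fix i assume "i \<in> ?R"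
      then obtain q x where "q < l" "(x, y) \<in> dom (T q r)" "i = blk q 0 * p + x" by blast
      then show "i \<in> {i. (i, j) \<in> dom (?U r)}"
        unfolding mem_Collect_eq dom_iff[OF r] using blk ay(3) by (intro bexI[of _ "blk q"]) auto
    qed
    also have "card \<dots> = (\<Sum>q<l. card (?A q))"
    proof (rule card_UN_image)
      show "finite (?A q)" if "q \<in> {..<l}" for q
        using finite_subset[OF A] that by simp
      show "q = q' \<and> x = x'"
        if q: "q \<in> {..<l}" "q' \<in> {..<l}" and x: "x \<in> ?A q" "x' \<in> ?A q'"
          and eq: "blk q 0 * p + x = blk q' 0 * p + x'" for q q' x x'
      proof -
        have "x < p" "x' < p" using A q x by blast+
        then have *: "blk q 0 = blk q' 0" "x = x'" using eq digits_eq_iff by blast+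
        then have "blk q 3 = blk q' 3"
          using same_block[of "blk q" "blk q'" 1 0 3] blk q by simp
        then show ?thesis using blk q * by simp
      qed
    qed simp
    also have "\<dots> = (\<Sum>q<l. k q)"
      using T r ay(2) by (intro sum.cong) (auto simp: homogeneous_latin_trade_def)
    finally show ?thesis .
  qed
  moreover have "card {c. ?U r c = Some s} = (\<Sum>q<l. k q)" if r: "r < \<mu>" and s: "s < l * p" for r s
  proof -
    obtain a z where az: "a < l" "z < p" "s = a * p + z" using digitsE[OF s] .
    have "\<forall>q\<in>{..<l}. \<exists>b. b \<in> B \<and> b 2 = a \<and> b 3 = q"
      using block[of 2 3 a] az(1) by auto
    then obtain blk where blk: "\<And>q. q < l \<Longrightarrow> blk q \<in> B \<and> blk q 2 = a \<and> blk q 3 = q"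
      by (metis lessThan_iff)
    let ?A = "\<lambda>q. {c. T q r c = Some z}"
    let ?h = "\<lambda>q (x, y). (blk q 0 * p + x, blk q 1 * p + y)"
    have A: "?A q \<subseteq> {..<p} \<times> {..<p}" if "q < l" for q
      using bound[OF that r] by auto
    have "{c. ?U r c = Some s} = (\<Union>q\<in>{..<l}. ?h q ` ?A q)" (is "_ = ?R")
    proof (intro set_eqI iffI)
      fix c assume "c \<in> {c. ?U r c = Some s}"
      then obtain i j where c: "c = (i, j)" and U: "?U r (i, j) = Some s" by (cases c) auto
      obtain b x y z' where b: "b \<in> B" and z': "T (b 3) r (x, y) = Some z'"
        and eq: "i = b 0 * p + x" "j = b 1 * p + y" "s = b 2 * p + z'"
        using U unfolding U_Some_iff[OF r] by blast
      have w: "b 3 < l" using pt b by simp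
      have "z' < p" using bound[OF w r z'] by blast
      then have bz: "b 2 = a" "z' = z"
        using eq(3) az digits_eq_iff by metis+
      have "blk (b 3) e = b e" if "e < 4" for e
        using same_block[of "blk (b 3)" b 2 3 e] blk[OF w] b bz that by simp
      then have "c = ?h (b 3) (x, y)" using c eq by simp
      then show "c \<in> ?R" using w z' bz(2) by blast
    next
      fix c assume "c \<in> ?R"
      then obtain q x y where "q < l" "T q r (x, y) = Some z" "c = (blk q 0 * p + x, blk q 1 * p + y)"
        by auto
      then have "?U r (blk q 0 * p + x, blk q 1 * p + y) = Some s"
        unfolding U_Some_iff[OF r] using blk az(3) by (intro bexI[of _ "blk q"]) auto
      then show "c \<in> {c. ?U r c = Some s}" using \<open>c = _\<close> by simp
    qed
    also have "card \<dots> = (\<Sum>q<l. card (?A q))"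
    proof (rule card_UN_image)
      show "finite (?A q)" if "q \<in> {..<l}" for q
        using finite_subset[OF A] that by simp
      show "q = q' \<and> c = c'"
        if q: "q \<in> {..<l}" "q' \<in> {..<l}" and c: "c \<in> ?A q" "c' \<in> ?A q'"
          and h: "?h q c = ?h q' c'" for q q' c c'
      proof -
        obtain x y x' y' where xy: "c = (x, y)" "c' = (x', y')"
          by (metis surj_pair)
        have eq: "blk q 0 * p + x = blk q' 0 * p + x'" "blk q 1 * p + y = blk q' 1 * p + y'"
          using h by (simp_all add: xy)
        have "x < p" "x' < p" "y < p" "y' < p" using A q c xy by blast+
        then have *: "blk q 0 = blk q' 0" "x = x'" "y = y'" using eq digits_eq_iff by blast+
        then have "blk q 3 = blk q' 3"
          using same_block[of "blk q" "blk q'" 0 2 3] blk q by simp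
        then show ?thesis using blk q * xy by simp
      qed
    qed simp
    also have "\<dots> = (\<Sum>q<l. k q)"
      using T r az(2) by (intro sum.cong) (auto simp: homogeneous_latin_trade_def)
    finally show ?thesis .
  qed
  moreover have "(\<Sum>q<l. k q) = 0 \<or> \<mu> \<le> (\<Sum>q<l. k q) \<and> (\<Sum>q<l. k q) \<le> l * p"
  proof (cases "\<exists>q<l. k q \<noteq> 0")
    case True
    then obtain q where q: "q < l" "k q \<noteq> 0" by blast
    then have "\<mu> \<le> k q" using T[OF q(1)] by (auto simp: homogeneous_latin_trade_def)
    also have "k q \<le> (\<Sum>q<l. k q)" using q(1) by (intro member_le_sum) auto
    finally have "\<mu> \<le> (\<Sum>q<l. k q)" .
    moreover have "k q \<le> p" if "q < l" for q
      using T[OF that] by (auto simp: homogeneous_latin_trade_def)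
    then have "(\<Sum>q<l. k q) \<le> (\<Sum>q<l. p)"
      by (intro sum_mono) simp
    ultimately show ?thesis by simp
  qed simp
  ultimately show ?thesis
    unfolding homogeneous_latin_trade_def by simp
qed

theorem theorem2:
  fixes \<mu> p l :: nat and k :: "nat \<Rightarrow> nat"
  assumes "\<mu> > 0" and "p > 0" and "l > 0" and "l \<noteq> 2" and "l \<noteq> 6"
    and "\<And>i. i \<in> {1..l} \<Longrightarrow>
           \<exists>(S :: nat set) T. homogeneous_latin_trade \<mu> (k i) p S T"
  shows "\<exists>(S :: nat set) T. homogeneous_latin_trade \<mu> (\<Sum>i=1..l. k i) (l * p) S T"
proof -
  obtain B where B: "transversal_design 4 {..<l} B"
    using td_order_4_all[OF assms(3-5)] unfolding td_order_def by blast
  have "\<exists>T. homogeneous_latin_trade \<mu> (k (Suc q)) p {..<p} T" if q: "q < l" for q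
    using assms(6)[of "Suc q"] q homogeneous_latin_trade_standard_symbols
    by (metis Suc_leI atLeastAtMost_iff le_add1 plus_1_eq_Suc)
  then obtain T where T: "\<And>q. q < l \<Longrightarrow> homogeneous_latin_trade \<mu> (k (Suc q)) p {..<p} (T q)"
    by metis
  have "(\<Sum>i=1..l. k i) = (\<Sum>q<l. k (Suc q))"
    by (simp add: sum.atLeast1_atMost_eq)
  moreover have "homogeneous_latin_trade \<mu> (\<Sum>q<l. k (Suc q)) (l * p) {..<l * p} (blow_up p l B T)"
    by (rule homogeneous_latin_trade_blow_up[OF B T])
  ultimately show ?thesis
    by metis
qed

end
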